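(* Let $n\in\mathbb{N}$, let $K\subseteq\{1,\dots,n-1\}$ with $|K|\ge2$, and let $\epsilon\in\mathbb{Z}/2\mathbb{Z}$. Then there exists $V\in\mathrm{Fl}_{K;n}^{>0}$ such that $\sigma_\epsilon(V)\notin\mathrm{Fl}_{K;n}^{\ge0}$. In particular, $\sigma_\epsilon$ preserves neither $\mathrm{Fl}_{K;n}^{>0}$ nor $\mathrm{Fl}_{K;n}^{\ge0}$.
   Context: $\mathrm{Fl}_{K;n}(\mathbb{R})$ is the variety of partial flags $(V_k)_{k\in K}$ of subspaces $V_{k}\subset V_{k'}$ ($k<k'$) of $\mathbb{R}^n$ with $\dim V_k=k$; an invertible $n\times n$ matrix $g$ represents the flag whose $V_k$ is the span of the first $k$ columns of $g$. $\mathrm{Fl}_{K;n}^{>0}$ is the set of flags representable by an $n\times n$ matrix all of whose minors are positive, and $\mathrm{Fl}_{K;n}^{\ge0}$ is its closure in the Euclidean topology. For $\epsilon\in\mathbb{Z}/2\mathbb{Z}$, $\sigma_\epsilon\in\mathrm{GL}_n(\mathbb{R})$ is the linear map $\sigma_\epsilon(v_1,\dots,v_n)=(v_2,\dots,v_n,(-1)^{\epsilon-1}v_1)$, acting on flags by $\sigma_\epsilon((V_k)_{k\in K})=(\sigma_\epsilon(V_k))_{k\in K}$. *)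

theory Defs
  imports
    "HOL-Analysis.Function_Topology"
    "HOL-Library.Z2"
    "Jordan_Normal_Form.VS_Connect"
    "Jordan_Normal_Form.DL_Submatrix"
begin

abbreviation Rn :: "nat \<Rightarrow> (real, real vec) module" where
  "Rn n \<equiv> module_vec TYPE(real) n"

text \<open>A partial flag is an extensional function on \<open>K\<close>, so that equality of flags is equality
  of their members \<open>V k\<close> with \<open>k \<in> K\<close>.\<close>

definition Fl :: "nat \<Rightarrow> nat set \<Rightarrow> (nat \<Rightarrow> real vec set) set" where
  "Fl n K = {V \<in> (\<Pi>\<^sub>E k\<in>K. {W. VectorSpace.subspace class_ring W (Rn n) \<and>
                               vectorspace.dim class_ring (Rn n\<lparr>carrier := W\<rparr>) = k}).
             \<forall>k\<in>K. \<forall>k'\<in>K. k < k' \<longrightarrow> V k \<subseteq> V k'}"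

definition GL :: "nat \<Rightarrow> real mat set" where
  "GL n = {g \<in> carrier_mat n n. invertible_mat g}"

definition flag_of :: "nat \<Rightarrow> nat set \<Rightarrow> real mat \<Rightarrow> nat \<Rightarrow> real vec set" where
  "flag_of n K g = (\<lambda>k\<in>K. LinearCombinations.module.span class_ring (Rn n) {col g j |j. j < k})"

text \<open>Index sets \<open>I\<close>, \<open>J\<close> are subsets of \<open>{0,\<dots>,n-1}\<close>; the empty minor is \<open>1\<close> and imposes
  nothing. The minor for \<open>I = J = {..<n}\<close> shows that such a matrix is invertible.\<close>

definition all_minors_pos :: "nat \<Rightarrow> real mat \<Rightarrow> bool" where
  "all_minors_pos n g \<longleftrightarrow>
     (\<forall>I J. I \<subseteq> {..<n} \<longrightarrow> J \<subseteq> {..<n} \<longrightarrow> card I = card J \<longrightarrow> 0 < det (submatrix g I J))"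

definition Fl_pos :: "nat \<Rightarrow> nat set \<Rightarrow> (nat \<Rightarrow> real vec set) set" where
  "Fl_pos n K = {flag_of n K g |g. g \<in> carrier_mat n n \<and> all_minors_pos n g}"

text \<open>The Euclidean topology on matrices is that of the \<open>n\<^sup>2\<close> entries. On flags it is the quotient
  topology under \<open>flag_of n K\<close>, i.e. that of the homogeneous space \<open>GL\<^sub>n / P\<close> with \<open>P\<close> the parabolic
  subgroup of \<open>K\<close>.\<close>

definition mat_topology :: "nat \<Rightarrow> real mat topology" where
  "mat_topology n = pullback_topology (carrier_mat n n) (\<lambda>g. \<lambda>ij\<in>{..<n} \<times> {..<n}. g $$ ij)
     (product_topology (\<lambda>_. euclideanreal) ({..<n} \<times> {..<n}))"

definition flag_topology :: "nat \<Rightarrow> nat set \<Rightarrow> (nat \<Rightarrow> real vec set) topology" where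
  "flag_topology n K = topology (\<lambda>U. U \<subseteq> Fl n K \<and>
     openin (subtopology (mat_topology n) (GL n)) {g \<in> GL n. flag_of n K g \<in> U})"

lemma openin_flag_topology:
  "openin (flag_topology n K) U \<longleftrightarrow> U \<subseteq> Fl n K \<and>
     openin (subtopology (mat_topology n) (GL n)) {g \<in> GL n. flag_of n K g \<in> U}"
proof -
  have "istopology (\<lambda>U. U \<subseteq> Fl n K \<and>
     openin (subtopology (mat_topology n) (GL n)) {g \<in> GL n. flag_of n K g \<in> U})"
    (is "istopology ?P")
    unfolding istopology_def
  proof (intro conjI allI impI)
    fix S T assume "?P S" "?P T"
    moreover have "{g \<in> GL n. flag_of n K g \<in> S \<inter> T} =
        {g \<in> GL n. flag_of n K g \<in> S} \<inter> {g \<in> GL n. flag_of n K g \<in> T}"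
      by auto
    ultimately show "S \<inter> T \<subseteq> Fl n K"
      and "openin (subtopology (mat_topology n) (GL n)) {g \<in> GL n. flag_of n K g \<in> S \<inter> T}"
      by auto
  next
    fix \<U> assume *: "\<forall>U\<in>\<U>. ?P U"
    have "{g \<in> GL n. flag_of n K g \<in> \<Union>\<U>} = (\<Union>U\<in>\<U>. {g \<in> GL n. flag_of n K g \<in> U})"
      by auto
    then show "openin (subtopology (mat_topology n) (GL n)) {g \<in> GL n. flag_of n K g \<in> \<Union>\<U>}"
      using * by auto
    show "\<Union>\<U> \<subseteq> Fl n K"
      using * by auto
  qed
  then show ?thesis
    unfolding flag_topology_def by (simp add: topology_inverse')
qed

definition Fl_nonneg :: "nat \<Rightarrow> nat set \<Rightarrow> (nat \<Rightarrow> real vec set) set" where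
  "Fl_nonneg n K = flag_topology n K closure_of Fl_pos n K"

text \<open>The type \<open>bit\<close> is the field with two elements, and \<open>of_bit\<close> takes the representative \<open>0\<close> or \<open>1\<close>.\<close>

definition cyc :: "nat \<Rightarrow> bit \<Rightarrow> real vec \<Rightarrow> real vec" where
  "cyc n \<epsilon> v = vec n (\<lambda>i. if i + 1 < n then v $ (i + 1) else (- 1) ^ (of_bit (\<epsilon> - 1) :: nat) * v $ 0)"

definition cyc_flag :: "nat \<Rightarrow> nat set \<Rightarrow> bit \<Rightarrow> (nat \<Rightarrow> real vec set) \<Rightarrow> nat \<Rightarrow> real vec set" where
  "cyc_flag n K \<epsilon> V = (\<lambda>k\<in>K. cyc n \<epsilon> ` V k)"

end

theory Submission
  imports Defs "Jordan_Normal_Form.DL_Rank"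
begin

text \<open>Write \<open>\<Delta>\<^sub>k(q)\<close> for the minor of the rows \<open>1, \<dots>, k - 1, q\<close> and the first \<open>k\<close> columns. These
  minors are Pluecker coordinates of \<open>V\<^sub>k\<close>, so they are determined by the flag up to a scalar that
  does not depend on \<open>q\<close>. On totally positive flags they are positive, and the three-term Pluecker
  relations make \<open>\<Delta>\<^sub>k(a) / \<Delta>\<^sub>k(b)\<close> decreasing in \<open>k\<close> whenever \<open>k \<le> a < b\<close>. Both properties pass to the
  closure as weak inequalities between sign-invariant polynomials in the minors.

  After the cyclic shift, \<open>\<Delta>\<^sub>k(n)\<close> is the minor of the rows \<open>1, \<dots>, k\<close> up to the sign
  \<open>(-1)\<^bsup>\<epsilon> - 1\<^esup> (-1)\<^bsup>k - 1\<^esup>\<close>. If this sign is negative for some \<open>k \<in> K\<close>, positivity fails. Otherwise take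
  \<open>k < l\<close> in \<open>K\<close>: the shift violates the monotonicity of \<open>\<Delta>\<^sub>k(l) / \<Delta>\<^sub>k(n)\<close> for a suitable Cauchy matrix
  \<open>1 / (x\<^sub>i + y\<^sub>j)\<close>, all of whose minors are explicit. The nodes that come after the first \<open>l\<close> of the
  \<open>x\<^sub>i\<close>, and all the \<open>y\<^sub>j\<close>, have to be large.\<close>

section \<open>Flags, Pluecker coordinates and the topology of the flag variety\<close>

text \<open>Rows are listed by a map rather than a set, so the minor is alternating in them and
  Pluecker relations need no order or distinctness.\<close>

definition flag_minor :: "real mat \<Rightarrow> nat \<Rightarrow> (nat \<Rightarrow> nat) \<Rightarrow> real" where
  "flag_minor g m r = det (mat m m (\<lambda>(i, j). g $$ (r i, j)))"

lemma GL_iff_det: "g \<in> GL n \<longleftrightarrow> g \<in> carrier_mat n n \<and> det g \<noteq> 0"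
proof (cases "g \<in> carrier_mat n n")
  case g: True
  have "det g \<noteq> 0" if "invertible_mat g"
  proof -
    obtain B where B: "g * B = 1\<^sub>m n" "B * g = 1\<^sub>m (dim_row B)"
      using \<open>invertible_mat g\<close> g unfolding invertible_mat_def inverts_mat_def by auto
    \<comment> \<open>\<open>inverts_mat\<close> leaves the size of \<open>B\<close> open; the two
      products determine it.\<close>
    have "dim_col B = n"
      using arg_cong[OF B(1), of dim_col] by simp
    moreover have "dim_row B = n"
      using arg_cong[OF B(2), of dim_col] g by simp
    ultimately have "B \<in> carrier_mat n n"
      by auto
    with g B(1) have "det g * det B = 1"
      by (metis det_mult det_one)
    then show ?thesis
      by auto
  qed
  moreover have "invertible_mat g" if "det g \<noteq> 0"
  proof -
    have "g \<in> Units (ring_mat TYPE(real) n ())"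
      using g that by (rule det_non_zero_imp_unit)
    then obtain B where "B \<in> carrier_mat n n" "B * g = 1\<^sub>m n" "g * B = 1\<^sub>m n"
      by (auto simp: Units_def ring_mat_def)
    with g show ?thesis
      by (auto simp: invertible_mat_def inverts_mat_def)
  qed
  ultimately show ?thesis
    using g by (auto simp: GL_def)
qed (auto simp: GL_def)

context
  fixes n k :: nat and g :: "real mat"
  assumes g: "g \<in> carrier_mat n n" and k: "k \<le> n"
begin

lemma initial_cols: "{col g j |j. j < k} = set (cols (mat n k (($$) g)))"
proof -
  have "col (mat n k (($$) g)) j = col g j" if "j < k" for j
    using g k that by (intro eq_vecI) auto
  then show ?thesis
    by (auto simp: cols_def image_iff)
qed

text \<open>The span becomes the image of a matrix, the form in which flags are compared and
  transformed below.\<close>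

lemma flag_of_eq_range:
  assumes "k \<in> K"
  shows "flag_of n K g k = {mat n k (($$) g) *\<^sub>v c |c. c \<in> carrier_vec k}"
proof -
  interpret vec_space "TYPE(real)" n .
  have "flag_of n K g k = col_space (mat n k (($$) g))"
    using assms by (simp add: flag_of_def initial_cols col_space_def)
  also have "\<dots> = {mat n k (($$) g) *\<^sub>v c |c. c \<in> carrier_vec k}"
    by (subst col_space_eq[of _ k]) (auto intro!: mult_mat_vec_carrier[OF mat_carrier])
  finally show ?thesis .
qed

lemma dim_flag_member:
  assumes "det g \<noteq> 0"
  shows "vectorspace.dim class_ring (Rn n\<lparr>carrier :=
    LinearCombinations.module.span class_ring (Rn n) {col g j |j. j < k}\<rparr>) = k"
proof -
  interpret vec_space "TYPE(real)" n .
  let ?G = "mat n k (($$) g)"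
  \<comment> \<open>Linear independence concerns the set of columns, so repetitions are ruled out
    separately.\<close>
  have dist: "distinct (cols g)"
  proof (rule ccontr)
    assume "\<not> distinct (cols g)"
    then obtain i j where "i < n" "j < n" "i \<noteq> j" "col g i = col g j"
      using g by (auto simp: distinct_conv_nth)
    then show False
      using det_identical_cols[OF g] \<open>det g \<noteq> 0\<close> by auto
  qed
  have indep: "lin_indpt (set (cols g))"
    using lin_depE[OF g _ dist] det_0_iff_vec_prod_zero_field[OF g] \<open>det g \<noteq> 0\<close> by metis
  have "cols ?G = take k (cols g)"
    using g k by (intro nth_equalityI) (auto intro!: eq_vecI)
  then have "distinct (cols ?G)" "set (cols ?G) \<subseteq> set (cols g)"
    using dist by (auto dest: in_set_takeD)
  moreover have "lin_indpt (set (cols ?G))"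
    using indep calculation(2) by (meson supset_ld_is_ld)
  ultimately have "rank ?G = k"
    by (intro lin_indpt_full_rank) auto
  then show ?thesis
    by (simp add: rank_def initial_cols)
qed

end

lemma flag_of_in_Fl:
  assumes "g \<in> GL n" and "K \<subseteq> {..n}"
  shows "flag_of n K g \<in> Fl n K"
proof -
  interpret vec_space "TYPE(real)" n .
  have g: "g \<in> carrier_mat n n" "det g \<noteq> 0"
    using assms by (auto simp: GL_iff_det)
  have sub: "{col g j |j. j < k} \<subseteq> carrier_vec n" for k
    using g by auto
  have dim: "vectorspace.dim class_ring (vs (span {col g j |j. j < k})) = k" if "k \<in> K" for k
    using dim_flag_member[OF g(1) _ g(2)] assms(2) that by blast
  have mono: "span {col g j |j. j < k} \<subseteq> span {col g j |j. j < k'}" if "k < k'" for k k'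
    by (rule span_is_monotone) (use that in auto)
  show ?thesis
    unfolding Fl_def flag_of_def
    by (auto intro!: dim span_is_subspace[OF sub] dest!: subsetD[OF mono])
qed

text \<open>Matrices with the same flag differ by a block upper triangular factor on the right, whose
  leading principal minors are the factors \<open>d\<close>.\<close>

lemma flag_minor_same_flag:
  assumes g: "g \<in> carrier_mat n n" and h: "h \<in> carrier_mat n n" and k: "k \<in> K" "k \<le> n"
    and eq: "flag_of n K g = flag_of n K h"
  obtains d where "\<And>r. (\<And>i. i < k \<Longrightarrow> r i < n) \<Longrightarrow> flag_minor h k r = flag_minor g k r * d"
proof -
  have "\<exists>c. c \<in> carrier_vec k \<and> (\<forall>i<n. h $$ (i, j) = row (mat n k (($$) g)) i \<bullet> c)" if "j < k" for j
  proof -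
    \<comment> \<open>This is column \<open>j\<close> of \<open>h\<close>, an element of the common
      subspace; \<open>c\<close> holds its coordinates in the columns of \<open>g\<close>.\<close>
    have "mat n k (($$) h) *\<^sub>v unit_vec k j \<in> flag_of n K h k"
      using flag_of_eq_range[OF h k(2,1)] by auto
    then obtain c where c: "c \<in> carrier_vec k"
      and "mat n k (($$) h) *\<^sub>v unit_vec k j = mat n k (($$) g) *\<^sub>v c"
      using flag_of_eq_range[OF g k(2,1)] eq by auto
    then have *: "(mat n k (($$) h) *\<^sub>v unit_vec k j) $ i = (mat n k (($$) g) *\<^sub>v c) $ i" for i
      by simp
    have "h $$ (i, j) = row (mat n k (($$) g)) i \<bullet> c" if "i < n" for i
      using *[of i] that \<open>j < k\<close> by (simp add: scalar_prod_right_unit)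
    with c show ?thesis
      by blast
  qed
  then obtain c where c: "\<And>j. j < k \<Longrightarrow> c j \<in> carrier_vec k"
    "\<And>i j. j < k \<Longrightarrow> i < n \<Longrightarrow> h $$ (i, j) = row (mat n k (($$) g)) i \<bullet> c j"
    by metis
  \<comment> \<open>The base change from the columns of \<open>g\<close> to those of
    \<open>h\<close>. It is fixed before \<open>r\<close>, so one factor serves all choices of
    rows.\<close>
  define P where "P = mat k k (\<lambda>(i, j). c j $ i)"
  have "flag_minor h k r = flag_minor g k r * det P" if r: "\<And>i. i < k \<Longrightarrow> r i < n" for r
  proof -
    have "mat k k (\<lambda>(i, j). h $$ (r i, j)) = mat k k (\<lambda>(i, j). g $$ (r i, j)) * P"
      using r carrier_vecD[OF c(1)] c(2)
      by (intro eq_matI) (auto simp: P_def scalar_prod_def intro!: sum.cong)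
    then show ?thesis
      unfolding flag_minor_def by (metis det_mult P_def mat_carrier)
  qed
  then show thesis
    using that by blast
qed

section \<open>Continuity of minors and the closure of the positive flags\<close>

lemma continuous_map_mat_entry:
  assumes "i < n" and "j < n"
  shows "continuous_map (mat_topology n) euclideanreal (\<lambda>g. g $$ (i, j))"
proof -
  have "continuous_map (product_topology (\<lambda>_. euclideanreal) ({..<n} \<times> {..<n})) euclideanreal
      (\<lambda>f. f (i, j))"
    using assms by (intro continuous_map_product_projection) auto
  from continuous_map_pullback[OF this, of "carrier_mat n n"
      "\<lambda>g. \<lambda>ij\<in>{..<n} \<times> {..<n}. g $$ ij"]
  show ?thesis
    using assms by (simp add: mat_topology_def o_def)
qed

text \<open>By the Leibniz formula a minor is a polynomial in the entries.\<close>

lemma continuous_map_flag_minor: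
  assumes "k \<le> n" and "\<And>i. i < k \<Longrightarrow> r i < n"
  shows "continuous_map (mat_topology n) euclideanreal (\<lambda>g. flag_minor g k r)"
proof -
  have less: "p i < k" if "p permutes {0..<k}" "i < k" for p i
    using permutes_in_image[OF that(1), of i] that(2) by simp
  have "flag_minor g k r =
      (\<Sum>p | p permutes {0..<k}. signof p * (\<Prod>i = 0..<k. g $$ (r i, p i)))" for g
    unfolding flag_minor_def
    by (subst det_def'[of _ k])
      (auto intro!: sum.cong prod.cong simp: less)
  moreover have "continuous_map (mat_topology n) euclideanreal
      (\<lambda>g. \<Sum>p | p permutes {0..<k}. signof p * (\<Prod>i = 0..<k. g $$ (r i, p i)))"
    using assms
    by (intro continuous_map_sum continuous_map_real_mult continuous_map_prod
        continuous_map_mat_entry finite_permutations)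
      (auto dest: less)
  ultimately show ?thesis
    by simp
qed

lemma topspace_mat_topology: "topspace (mat_topology n) = carrier_mat n n"
  by (auto simp: mat_topology_def topspace_pullback_topology)

lemma topspace_flag_topology:
  assumes "K \<subseteq> {..n}"
  shows "topspace (flag_topology n K) = Fl n K"
proof
  have "{g \<in> GL n. flag_of n K g \<in> Fl n K} = topspace (subtopology (mat_topology n) (GL n))"
    using flag_of_in_Fl[OF _ assms] by (auto simp: topspace_mat_topology GL_def)
  then have "openin (flag_topology n K) (Fl n K)"
    unfolding openin_flag_topology by (simp only: openin_topspace order_refl simp_thms)
  then show "Fl n K \<subseteq> topspace (flag_topology n K)"
    by (rule openin_subset)
  show "topspace (flag_topology n K) \<subseteq> Fl n K"
    using openin_topspace[of "flag_topology n K"] unfolding openin_flag_topology by (rule conjunct1)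
qed

lemma submatrix_full:
  assumes "g \<in> carrier_mat n n"
  shows "submatrix g {..<n} {..<n} = g"
proof -
  have "pick {..<n} i = i" if "i < n" for i
    using pick_reduce_set[of i n UNIV] that by (simp add: pick_UNIV lessThan_def)
  with assms show ?thesis
    by (auto simp: submatrix_def)
qed

lemma all_minors_pos_imp_GL:
  assumes "g \<in> carrier_mat n n" and "all_minors_pos n g"
  shows "g \<in> GL n"
proof -
  have "0 < det (submatrix g {..<n} {..<n})"
    using assms(2) unfolding all_minors_pos_def by blast
  then show ?thesis
    using assms(1) by (simp add: submatrix_full GL_iff_det)
qed

lemma Fl_pos_subset_Fl:
  assumes "K \<subseteq> {..n}"
  shows "Fl_pos n K \<subseteq> Fl n K"
  using assms by (auto simp: Fl_pos_def all_minors_pos_imp_GL intro!: flag_of_in_Fl)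

lemma Fl_pos_subset_Fl_nonneg:
  assumes "K \<subseteq> {..n}"
  shows "Fl_pos n K \<subseteq> Fl_nonneg n K"
  unfolding Fl_nonneg_def
  using assms by (intro closure_of_subset) (simp add: topspace_flag_topology Fl_pos_subset_Fl)

text \<open>By \<open>scale\<close> the sign of \<open>F\<close> depends on the flag only, so
  \<open>F < 0\<close> cuts out an open set of flags; by \<open>pos\<close> it misses the positive
  flags, hence also their closure.\<close>

lemma flag_of_notin_Fl_nonneg:
  assumes K: "K \<subseteq> {..n}" and h: "h \<in> GL n" and neg: "F h < 0"
    and cont: "continuous_map (mat_topology n) euclideanreal F"
    and scale: "\<And>g g'. g \<in> GL n \<Longrightarrow> g' \<in> GL n \<Longrightarrow> flag_of n K g = flag_of n K g' \<Longrightarrow>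
      \<exists>d. F g' = F g * d\<^sup>2"
    and pos: "\<And>g. g \<in> carrier_mat n n \<Longrightarrow> all_minors_pos n g \<Longrightarrow> 0 \<le> F g"
  shows "flag_of n K h \<notin> Fl_nonneg n K"
proof
  assume closure: "flag_of n K h \<in> Fl_nonneg n K"
  define U where "U = flag_of n K ` {g \<in> GL n. F g < 0}"
  \<comment> \<open>The set \<open>F < 0\<close> is saturated: it is the full preimage of
    \<open>U\<close>, as the quotient topology requires.\<close>
  have neg_iff: "F g < 0" if g: "g \<in> GL n" and gU: "flag_of n K g \<in> U" for g
  proof -
    obtain g' where g': "g' \<in> GL n" "F g' < 0" "flag_of n K g = flag_of n K g'"
      using gU unfolding U_def by blast
    with scale[OF g] obtain d where "F g' = F g * d\<^sup>2"
      by blast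
    with g'(2)
    show ?thesis
      by (metis mult_nonneg_nonneg not_less zero_le_power2)
  qed
  then have "{g \<in> GL n. flag_of n K g \<in> U} = GL n \<inter> {g \<in> topspace (mat_topology n). F g \<in> {..<0}}"
    by (auto simp: U_def topspace_mat_topology GL_def)
  moreover have "openin (mat_topology n) {g \<in> topspace (mat_topology n). F g \<in> {..<0}}"
    using cont by (rule openin_continuous_map_preimage) auto
  ultimately have "openin (flag_topology n K) U"
    using K flag_of_in_Fl unfolding openin_flag_topology
    by (auto simp: U_def openin_subtopology_Int2)
  moreover have "flag_of n K h \<in> U"
    using h neg by (auto simp: U_def)
  ultimately obtain W where "W \<in> Fl_pos n K" "W \<in> U"
    using closure unfolding Fl_nonneg_def in_closure_of by blast
  then obtain g where "g \<in> carrier_mat n n" "all_minors_pos n g" "flag_of n K g \<in> U"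
    by (auto simp: Fl_pos_def)
  then show False
    using neg_iff pos all_minors_pos_imp_GL by force
qed

section \<open>Determinants\<close>

text \<open>Block elimination: the matrix is a unipotent lower triangular factor times an upper
  triangular one with diagonal blocks \<open>A\<close> and the Schur complement.\<close>

lemma det_four_block_mat_schur:
  fixes A :: "'a::field mat"
  assumes A: "A \<in> carrier_mat p p" and B: "B \<in> carrier_mat p d"
    and C: "C \<in> carrier_mat d p" and D: "D \<in> carrier_mat d d"
    and Ai: "Ai \<in> carrier_mat p p" and inv: "Ai * A = 1\<^sub>m p"
  shows "det (four_block_mat A B C D) = det A * det (D - C * (Ai * B))"
proof -
  define X where "X = C * (Ai * B)"
  have X: "X \<in> carrier_mat d d" and CAi: "C * Ai \<in> carrier_mat d p"
    using B C Ai by (auto simp: X_def)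
  let ?L = "four_block_mat (1\<^sub>m p) (0\<^sub>m p d) (C * Ai) (1\<^sub>m d)"
  let ?U = "four_block_mat A B (0\<^sub>m d p) (D - X)"
  have S: "D - X \<in> carrier_mat d d"
    using D X by auto
  have "?L * ?U = four_block_mat (1\<^sub>m p * A + 0\<^sub>m p d * 0\<^sub>m d p) (1\<^sub>m p * B + 0\<^sub>m p d * (D - X))
      (C * Ai * A + 1\<^sub>m d * 0\<^sub>m d p) (C * Ai * B + 1\<^sub>m d * (D - X))"
    by (rule mult_four_block_mat[OF _ _ CAi _ A B _ S]) auto
  moreover have "1\<^sub>m p * A + 0\<^sub>m p d * 0\<^sub>m d p = A" "1\<^sub>m p * B + 0\<^sub>m p d * (D - X) = B"
    using A B by (simp_all add: left_mult_zero_mat[OF S])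
  moreover have "C * Ai * A + 1\<^sub>m d * 0\<^sub>m d p = C"
    unfolding assoc_mult_mat[OF C Ai A] inv using C by auto
  moreover have "C * Ai * B + 1\<^sub>m d * (D - X) = D"
    unfolding assoc_mult_mat[OF C Ai B] X_def[symmetric] left_mult_one_mat[OF S]
    using D X by (intro eq_matI) auto
  ultimately have "four_block_mat A B C D = ?L * ?U"
    by (simp only:)
  moreover have "det (?L * ?U) = det ?L * det ?U"
    by (rule det_mult[of _ "p + d"]) (use A S in auto)
  moreover have "det ?L = 1"
    using CAi by (subst det_four_block_mat_upper_right_zero[of _ p _ d]) auto
  moreover have "det ?U = det A * det (D - X)"
    using A B S by (intro det_four_block_mat_lower_left_zero) auto
  ultimately show ?thesis
    by (simp only: X_def mult_1_left)
qed

lemma det_mat_Suc_0: "det (mat (Suc 0) (Suc 0) f) = (f (0, 0) :: 'a::comm_ring_1)"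
  by (subst det_single) auto

lemma det_mat_2:
  "det (mat 2 2 f) = (f (0, 0) * f (1, 1) - f (0, 1) * f (1, 0) :: 'a::comm_ring_1)"
proof -
  have "mat_delete (mat 2 2 f) 0 0 = mat (Suc 0) (Suc 0) (\<lambda>_. f (1, 1))"
    "mat_delete (mat 2 2 f) 0 1 = mat (Suc 0) (Suc 0) (\<lambda>_. f (1, 0))"
    by (rule eq_matI; simp add: mat_delete_def)+
  moreover have "det (mat 2 2 f) = (\<Sum>j<2. mat 2 2 f $$ (0, j) * cofactor (mat 2 2 f) 0 j)"
    by (rule laplace_expansion_row) auto
  moreover have "{..<2} = {0, 1 :: nat}"
    by auto
  ultimately show ?thesis
    by (simp add: cofactor_def det_mat_Suc_0)
qed

text \<open>Schur complement of the rows and columns with index less than \<open>p\<close>: \<open>s q t\<close> is the entry of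
  row \<open>q\<close> and column \<open>t\<close> after clearing the first \<open>p\<close> entries of row \<open>q\<close>.\<close>

lemma flag_minor_schur:
  assumes "det (mat p p (($$) g)) \<noteq> 0"
  obtains s where "\<And>d r. flag_minor g (p + d) (\<lambda>i. if i < p then i else r (i - p)) =
    det (mat p p (($$) g)) * det (mat d d (\<lambda>(i, j). s (r i) (p + j)))"
proof -
  let ?A = "mat p p (($$) g)"
  have "?A \<in> Units (ring_mat TYPE(real) p ())"
    using assms by (intro det_non_zero_imp_unit) auto
  then obtain Ai where Ai: "Ai \<in> carrier_mat p p" "Ai * ?A = 1\<^sub>m p"
    by (auto simp: Units_def ring_mat_def)
  \<comment> \<open>\<open>s\<close> refers to a single row and a single column, so the same
    \<open>s\<close> serves minors of every size.\<close>
  define s where "s q t = g $$ (q, t) -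
    vec p (\<lambda>j. g $$ (q, j)) \<bullet> (Ai *\<^sub>v vec p (\<lambda>i. g $$ (i, t)))" for q t
  have "flag_minor g (p + d) (\<lambda>i. if i < p then i else r (i - p)) =
    det ?A * det (mat d d (\<lambda>(i, j). s (r i) (p + j)))" for d r
  proof -
    let ?B = "mat p d (\<lambda>(i, j). g $$ (i, p + j))"
    let ?C = "mat d p (\<lambda>(i, j). g $$ (r i, j))"
    let ?D = "mat d d (\<lambda>(i, j). g $$ (r i, p + j))"
    have B: "?B \<in> carrier_mat p d"
      by simp
    have "mat (p + d) (p + d) (\<lambda>(i, j). g $$ (if i < p then i else r (i - p), j)) =
        four_block_mat ?A ?B ?C ?D"
      by (intro eq_matI) auto
    moreover have "?D - ?C * (Ai * ?B) = mat d d (\<lambda>(i, j). s (r i) (p + j))"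
    proof (rule eq_matI)
      fix i j
      assume "i < dim_row (mat d d (\<lambda>(i, j). s (r i) (p + j)))"
        "j < dim_col (mat d d (\<lambda>(i, j). s (r i) (p + j)))"
      then have ij: "i < d" "j < d"
        by auto
      have "col (Ai * ?B) j = Ai *\<^sub>v vec p (\<lambda>i. g $$ (i, p + j))"
        using col_mult2[OF Ai(1) B ij(2)] ij by (simp add: col_mat)
      moreover have "row ?C i = vec p (\<lambda>j. g $$ (r i, j))"
        using ij by (simp add: row_mat)
      ultimately show "(?D - ?C * (Ai * ?B)) $$ (i, j) = mat d d (\<lambda>(i, j). s (r i) (p + j)) $$ (i, j)"
        using ij Ai(1) by (simp add: s_def del: index_mult_mat_vec)
    qed (use Ai in auto)
    moreover have "det (four_block_mat ?A ?B ?C ?D) = det ?A * det (?D - ?C * (Ai * ?B))"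
      by (rule det_four_block_mat_schur[OF _ _ _ _ Ai]) auto
    ultimately show ?thesis
      by (simp add: flag_minor_def)
  qed
  then show thesis
    by (rule that)
qed

text \<open>Modulo the first \<open>p\<close> rows and columns, \<open>P\<close> and
  \<open>Q\<close> are the entries and the 2 by 2 minors of two columns of \<open>s\<close>, where
  the relation is a polynomial identity.\<close>

lemma flag_minor_plucker:
  assumes "det (mat p p (($$) g)) \<noteq> 0"
  defines "P \<equiv> \<lambda>q. flag_minor g (Suc p) (\<lambda>i. if i < p then i else q)"
    and "Q \<equiv> \<lambda>q q'. flag_minor g (Suc (Suc p)) (\<lambda>i. if i < p then i else if i = p then q else q')"
  shows "P a * Q c b - P b * Q c a = P c * Q a b"
proof -
  obtain s where s: "\<And>d r. flag_minor g (p + d) (\<lambda>i. if i < p then i else r (i - p)) =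
    det (mat p p (($$) g)) * det (mat d d (\<lambda>(i, j). s (r i) (p + j)))"
    using flag_minor_schur[OF assms(1)] by blast
  have P: "P q = det (mat p p (($$) g)) * s q p" for q
    using s[of 1 "\<lambda>_. q"] by (simp add: P_def det_mat_Suc_0)
  have Q: "Q q q' = det (mat p p (($$) g)) *
      (s q p * s q' (Suc p) - s q (Suc p) * s q' p)" for q q'
  proof -
    have "Q q q' = flag_minor g (p + 2) (\<lambda>i. if i < p then i else (if i - p = 0 then q else q'))"
      unfolding Q_def by (rule arg_cong2[of _ _ _ _ "flag_minor g"]) auto
    also have "\<dots> = det (mat p p (($$) g)) *
        det (mat 2 2 (\<lambda>(i, j). s (if i = 0 then q else q') (p + j)))"
      by (rule s[of 2 "\<lambda>i. if i = 0 then q else q'"])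
    finally show ?thesis
      by (simp add: det_mat_2)
  qed
  show ?thesis
    unfolding P Q by (simp add: algebra_simps)
qed

text \<open>Expansion along the moved row meets the same minors on both sides; only the signs of the
  cofactors differ, by \<open>(- 1) ^ m\<close>.\<close>

lemma det_rotate_rows:
  fixes f :: "nat \<Rightarrow> nat \<Rightarrow> 'a::comm_ring_1"
  shows "det (mat (Suc m) (Suc m) (\<lambda>(i, j). if i < m then f (Suc i) j else s * f 0 j)) =
    s * (- 1) ^ m * det (mat (Suc m) (Suc m) (\<lambda>(i, j). f i j))"
    (is "det ?L = _ * det ?R")
proof -
  have "mat_delete ?L m j = mat_delete ?R 0 j" for j
    by (auto simp: mat_delete_def)
  then have "?L $$ (m, j) * cofactor ?L m j = s * (- 1) ^ m * (?R $$ (0, j) * cofactor ?R 0 j)"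
    if "j < Suc m" for j
    using that by (simp add: cofactor_def power_add mult_ac)
  then have "(\<Sum>j<Suc m. ?L $$ (m, j) * cofactor ?L m j) =
      s * (- 1) ^ m * (\<Sum>j<Suc m. ?R $$ (0, j) * cofactor ?R 0 j)"
    unfolding sum_distrib_left by (intro sum.cong refl) (simp only: lessThan_iff)
  moreover have "det ?L = (\<Sum>j<Suc m. ?L $$ (m, j) * cofactor ?L m j)"
    by (rule laplace_expansion_row) auto
  moreover have "det ?R = (\<Sum>j<Suc m. ?R $$ (0, j) * cofactor ?R 0 j)"
    by (rule laplace_expansion_row) auto
  ultimately show ?thesis
    by (simp only:)
qed

text \<open>Each Leibniz term contains every \<open>a i\<close> and every \<open>b j\<close> exactly
  once.\<close>

lemma det_scale_rows_cols:
  fixes c :: "nat \<Rightarrow> nat \<Rightarrow> 'a::comm_ring_1"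
  shows "det (mat m m (\<lambda>(i, j). a i * b j * c i j)) =
    (\<Prod>i<m. a i) * (\<Prod>j<m. b j) * det (mat m m (\<lambda>(i, j). c i j))"
proof -
  have less: "p i < m" if "p permutes {0..<m}" "i < m" for p i
    using permutes_in_image[OF that(1), of i] that(2) by simp
  have det: "det (mat m m (\<lambda>(i, j). F i j)) =
      (\<Sum>p | p permutes {0..<m}. signof p * (\<Prod>i = 0..<m. F i (p i)))"
    for F :: "nat \<Rightarrow> nat \<Rightarrow> 'a"
    by (subst det_def'[of _ m]) (auto intro!: sum.cong prod.cong simp: less)
  have "(\<Prod>i = 0..<m. a i * b (p i) * c i (p i)) =
      (\<Prod>i<m. a i) * (\<Prod>j<m. b j) * (\<Prod>i = 0..<m. c i (p i))" if "p permutes {0..<m}" for p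
    using prod.permute[OF that, of b] by (simp add: prod.distrib o_def lessThan_atLeast0)
  then show ?thesis
    unfolding det sum_distrib_left by (intro sum.cong) (simp_all add: mult_ac)
qed

section \<open>Cauchy determinants and their positivity\<close>

abbreviation cauchy_mat :: "nat \<Rightarrow> (nat \<Rightarrow> real) \<Rightarrow> (nat \<Rightarrow> real) \<Rightarrow> real mat" where
  "cauchy_mat m x y \<equiv> mat m m (\<lambda>(i, j). 1 / (x i + y j))"

text \<open>The Schur complement of the top left entry is again a Cauchy matrix, up to factors
  attached to single rows and columns.\<close>

lemma det_cauchy_mat_Suc:
  assumes pos: "\<And>i j. i \<le> m \<Longrightarrow> j \<le> m \<Longrightarrow> 0 < x i + y j"
  shows "det (cauchy_mat (Suc m) x y) =
    (\<Prod>i<m. x (Suc i) - x 0) / (\<Prod>j\<le>m. x 0 + y j) *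
    ((\<Prod>j<m. y (Suc j) - y 0) / (\<Prod>i<m. x (Suc i) + y 0) *
      det (cauchy_mat m (\<lambda>i. x (Suc i)) (\<lambda>j. y (Suc j))))"
proof -
  let ?A = "mat 1 1 (\<lambda>_. 1 / (x 0 + y 0))"
  let ?Ai = "mat 1 1 (\<lambda>_. x 0 + y 0)"
  let ?B = "mat 1 m (\<lambda>(i, j). 1 / (x 0 + y (Suc j)))"
  let ?C = "mat m 1 (\<lambda>(i, j). 1 / (x (Suc i) + y 0))"
  let ?D = "cauchy_mat m (\<lambda>i. x (Suc i)) (\<lambda>j. y (Suc j))"
  let ?a = "\<lambda>i. (x (Suc i) - x 0) / (x (Suc i) + y 0)"
  let ?b = "\<lambda>j. (y (Suc j) - y 0) / (x 0 + y (Suc j))"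
  have nz: "x i + y j \<noteq> 0" if "i \<le> m" "j \<le> m" for i j
    using pos[OF that] by simp
  have "cauchy_mat (Suc m) x y = four_block_mat ?A ?B ?C ?D"
    by (intro eq_matI) (auto simp: less_Suc_eq_0_disj)
  moreover have "?D - ?C * (?Ai * ?B) =
      mat m m (\<lambda>(i, j). ?a i * ?b j * (1 / (x (Suc i) + y (Suc j))))"
  proof (rule eq_matI)
    fix i j
    assume "i < dim_row (mat m m (\<lambda>(i, j). ?a i * ?b j * (1 / (x (Suc i) + y (Suc j)))))"
      "j < dim_col (mat m m (\<lambda>(i, j). ?a i * ?b j * (1 / (x (Suc i) + y (Suc j)))))"
    then have ij: "i < m" "j < m"
      by auto
    \<comment> \<open>\<open>X\<close>, \<open>u\<close> are row nodes and \<open>Y\<close>,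
      \<open>v\<close> column nodes, with \<open>u\<close> and \<open>v\<close> those of the
      eliminated entry.\<close>
    have "1 / (X + Y) - 1 / (X + v) * ((u + v) * (1 / (u + Y))) =
        (X - u) / (X + v) * ((Y - v) / (u + Y)) * (1 / (X + Y))"
      if "X + Y \<noteq> 0" "X + v \<noteq> 0" "u + Y \<noteq> 0" for X Y u v :: real
      using that by (simp add: divide_simps) (simp add: algebra_simps)
    from this[of "x (Suc i)" "y (Suc j)" "y 0" "x 0"]
    show "(?D - ?C * (?Ai * ?B)) $$ (i, j) =
        mat m m (\<lambda>(i, j). ?a i * ?b j * (1 / (x (Suc i) + y (Suc j)))) $$ (i, j)"
      using ij nz by (simp add: scalar_prod_def)
  qed auto
  moreover have "?Ai * ?A = 1\<^sub>m 1"
    using nz by (intro eq_matI) (auto simp: scalar_prod_def)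
  then have "det (four_block_mat ?A ?B ?C ?D) = det ?A * det (?D - ?C * (?Ai * ?B))"
    by (intro det_four_block_mat_schur) auto
  ultimately have "det (cauchy_mat (Suc m) x y) =
      1 / (x 0 + y 0) * ((\<Prod>i<m. ?a i) * (\<Prod>j<m. ?b j) * det ?D)"
    by (simp only: det_scale_rows_cols) (simp add: det_mat_Suc_0)
  then show ?thesis
    by (simp add: prod_dividef prod.atMost_Suc_shift lessThan_Suc_atMost[symmetric]
        prod.lessThan_Suc_shift mult_ac del: prod.lessThan_Suc)
qed

text \<open>For increasing nodes every factor in the recursion is positive.\<close>

lemma det_cauchy_mat_pos:
  assumes "\<And>i j. i < j \<Longrightarrow> j < m \<Longrightarrow> x i < x j"
    and "\<And>i j. i < j \<Longrightarrow> j < m \<Longrightarrow> y i < y j"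
    and "\<And>i j. i < m \<Longrightarrow> j < m \<Longrightarrow> 0 < x i + y j"
  shows "0 < det (cauchy_mat m x y)"
  using assms
proof (induction m arbitrary: x y)
  case (Suc m)
  have "0 < det (cauchy_mat m (\<lambda>i. x (Suc i)) (\<lambda>j. y (Suc j)))"
    by (rule Suc.IH) (use Suc.prems in auto)
  moreover have "0 < (\<Prod>i<m. x (Suc i) - x 0)" "0 < (\<Prod>j<m. y (Suc j) - y 0)"
    by (intro prod_pos; use Suc.prems(1,2)[of 0] in simp)+
  moreover have "0 < (\<Prod>j\<le>m. x 0 + y j)" "0 < (\<Prod>i<m. x (Suc i) + y 0)"
    by (intro prod_pos; use Suc.prems(3) in simp)+
  moreover have "0 < x i + y j" if "i \<le> m" "j \<le> m" for i j
    using Suc.prems(3) that by simp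
  ultimately show ?case
    by (subst det_cauchy_mat_Suc) simp_all
qed simp

text \<open>Exactly \<open>i\<close> elements of the image lie below \<open>r i\<close>. This links
  minors given by index sets to those given by row maps.\<close>

lemma pick_image_strict_mono:
  assumes mono: "\<And>i j. i < j \<Longrightarrow> j < m \<Longrightarrow> r i < r j" and "i < m"
  shows "pick (r ` {..<m}) i = (r i :: nat)"
proof -
  have less_iff: "r j < r i \<longleftrightarrow> j < i" if "j < m" for j
    using mono[of i j] mono[of j i] that \<open>i < m\<close> by (cases i j rule: linorder_cases) auto
  have "inj_on r {..<m}"
  proof (rule linorder_inj_onI')
    show "r i \<noteq> r j" if "j \<in> {..<m}" "i < j" for i j
      using mono[OF that(2)] that(1) by simp
  qed
  moreover have "{a \<in> r ` {..<m}. a < r i} = r ` {..<i}"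
    using less_iff \<open>i < m\<close> by auto
  ultimately have "card {a \<in> r ` {..<m}. a < r i} = i"
    using \<open>i < m\<close> by (simp add: card_image[OF inj_on_subset])
  then show ?thesis
    using pick_card_in_set[of "r i" "r ` {..<m}"] \<open>i < m\<close> by auto
qed

section \<open>Total positivity and the cyclic shift\<close>

lemma dims_bounds:
  fixes K :: "nat set"
  assumes "K \<subseteq> {1..n - 1}"
  shows "k \<in> K \<Longrightarrow> 1 \<le> k" and "k \<in> K \<Longrightarrow> k < n" and "K \<subseteq> {..n}"
proof -
  have *: "1 \<le> k \<and> k < n" if "k \<in> K" for k
    using subsetD[OF assms that] by auto
  then show "k \<in> K \<Longrightarrow> 1 \<le> k" and "k \<in> K \<Longrightarrow> k < n"
    by blast+
  show "K \<subseteq> {..n}"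
    using * by (meson atMost_iff less_imp_le subsetI)
qed

lemma flag_minor_cong:
  "(\<And>i. i < m \<Longrightarrow> r i = r' i) \<Longrightarrow> flag_minor g m r = flag_minor g m r'"
  unfolding flag_minor_def by (intro arg_cong[of _ _ det] cong_mat) auto

lemma flag_minor_pos:
  assumes g: "g \<in> carrier_mat n n" and pos: "all_minors_pos n g" and "m \<le> n"
    and mono: "\<And>i j. i < j \<Longrightarrow> j < m \<Longrightarrow> r i < r j" and less: "\<And>i. i < m \<Longrightarrow> r i < n"
  shows "0 < flag_minor g m r"
proof -
  let ?I = "r ` {..<m}"
  have "inj_on r {..<m}"
  proof (rule linorder_inj_onI')
    show "r i \<noteq> r j" if "j \<in> {..<m}" "i < j" for i j
      using mono[OF that(2)] that(1) by simp
  qed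
  then have card: "card ?I = m"
    by (simp add: card_image)
  have "{i. i < n \<and> i \<in> ?I} = ?I" "{j. j < n \<and> j \<in> {..<m}} = {..<m}"
    using less \<open>m \<le> n\<close> by auto
  moreover have "pick ?I i = r i" "pick {..<m} i = i" if "i < m" for i
    using pick_image_strict_mono[of m r i] pick_image_strict_mono[of m "\<lambda>i. i" i] mono that by simp_all
  ultimately have "submatrix g ?I {..<m} = mat m m (\<lambda>(i, j). g $$ (r i, j))"
    using g card by (intro eq_matI) (simp_all add: submatrix_def)
  moreover have "?I \<subseteq> {..<n}" "{..<m} \<subseteq> {..<n}"
    using less \<open>m \<le> n\<close> by auto
  then have "0 < det (submatrix g ?I {..<m})"
    using pos[unfolded all_minors_pos_def, rule_format, of ?I "{..<m}"] card by simp
  ultimately show ?thesis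
    by (simp add: flag_minor_def)
qed

text \<open>A submatrix is the Cauchy matrix of the selected nodes, which are again
  increasing.\<close>

lemma all_minors_pos_cauchy_mat:
  assumes x: "strict_mono x" and y: "strict_mono y" and pos: "\<And>i j. 0 < x i + y j"
  shows "all_minors_pos n (cauchy_mat n x y)"
  unfolding all_minors_pos_def
proof (intro allI impI)
  fix I J :: "nat set"
  assume I: "I \<subseteq> {..<n}" and J: "J \<subseteq> {..<n}" and card: "card I = card J"
  have restrict: "{i. i < n \<and> i \<in> I} = I" "{i. i < n \<and> i \<in> J} = J"
    using I J by auto
  have "pick I i < n" "pick J i < n" if "i < card I" for i
    using pick_in_set_le[of i I] pick_in_set_le[of i J] I J that card by auto
  then have "submatrix (cauchy_mat n x y) I J =
      cauchy_mat (card I) (\<lambda>i. x (pick I i)) (\<lambda>j. y (pick J j))"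
    using card by (intro eq_matI) (simp_all add: submatrix_def restrict)
  moreover have "0 < det (cauchy_mat (card I) (\<lambda>i. x (pick I i)) (\<lambda>j. y (pick J j)))"
    using pick_mono_le[of _ I] pick_mono_le[of _ J] card pos
    by (intro det_cauchy_mat_pos) (simp_all add: strict_mono_less[OF x] strict_mono_less[OF y])
  ultimately show "0 < det (submatrix (cauchy_mat n x y) I J)"
    by simp
qed

text \<open>Rows are counted from \<open>0\<close>: the minor \<open>\<Delta>\<^sub>k(q)\<close> of the introduction is
  \<open>border_minor g (k - 1) (q - 1)\<close>.\<close>

definition border_minor :: "real mat \<Rightarrow> nat \<Rightarrow> nat \<Rightarrow> real" where
  "border_minor g p q = flag_minor g (Suc p) (\<lambda>i. if i < p then i else q)"

lemma border_minor_pos: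
  assumes "g \<in> carrier_mat n n" and "all_minors_pos n g" and "p \<le> q" and "q < n"
  shows "0 < border_minor g p q"
  unfolding border_minor_def using assms by (intro flag_minor_pos) auto

text \<open>In the Pluecker relation with \<open>c = p\<close>, the two sides differ by a product of
  two positive minors.\<close>

lemma border_minor_ratio_Suc:
  assumes g: "g \<in> carrier_mat n n" "all_minors_pos n g" and "p < a" and "a < b" and "b < n"
  shows "border_minor g p b * border_minor g (Suc p) a < border_minor g p a * border_minor g (Suc p) b"
proof -
  let ?Q = "\<lambda>q q'. flag_minor g (Suc (Suc p)) (\<lambda>i. if i < p then i else if i = p then q else q')"
  have "0 < flag_minor g p (\<lambda>i. i)"
    using assms by (intro flag_minor_pos[OF g]) auto
  then have "det (mat p p (($$) g)) \<noteq> 0"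
    by (simp add: flag_minor_def)
  from flag_minor_plucker[OF this, of a p b]
  have "border_minor g p a * ?Q p b - border_minor g p b * ?Q p a = border_minor g p p * ?Q a b"
    by (simp add: border_minor_def)
  moreover have "0 < border_minor g p p * ?Q a b"
    using assms by (intro mult_pos_pos border_minor_pos[OF g] flag_minor_pos[OF g]) auto
  moreover have "?Q p q = border_minor g (Suc p) q" for q
    unfolding border_minor_def by (intro flag_minor_cong) auto
  ultimately have "0 < border_minor g p a * border_minor g (Suc p) b -
      border_minor g p b * border_minor g (Suc p) a"
    by (simp only:)
  then show ?thesis
    by simp
qed

text \<open>The one-step inequalities are chained as inequalities of quotients, whose denominators
  are positive up to index \<open>a\<close>.\<close>

lemma border_minor_ratio_antimono:
  assumes g: "g \<in> carrier_mat n n" "all_minors_pos n g" and "p \<le> p'" and "p' \<le> a" and "a < b" and "b < n"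
  shows "border_minor g p b * border_minor g p' a \<le> border_minor g p a * border_minor g p' b"
  using \<open>p \<le> p'\<close> \<open>p' \<le> a\<close>
proof (induction p' rule: dec_induct)
  case (step m)
  let ?R = "\<lambda>p. border_minor g p a / border_minor g p b"
  have pos: "0 < border_minor g i b" if "i \<le> a" for i
    using assms that by (intro border_minor_pos[OF g]) auto
  have "?R (Suc m) \<le> ?R m"
    using border_minor_ratio_Suc[OF g, of m a b] step pos[of m] pos[of "Suc m"] assms
    by (simp add: field_simps)
  also have "?R m \<le> ?R p"
    using step pos[of m] pos[of p] by (simp add: field_simps)
  finally show ?case
    using step pos[of "Suc m"] pos[of p] by (simp add: field_simps)
qed simp

section \<open>The cyclic shift on matrices\<close>

definition cyc_sign :: "bit \<Rightarrow> real" where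
  "cyc_sign \<epsilon> = (- 1) ^ (of_bit (\<epsilon> - 1) :: nat)"

definition cyc_mat :: "nat \<Rightarrow> bit \<Rightarrow> real mat \<Rightarrow> real mat" where
  "cyc_mat n \<epsilon> g = mat n n (\<lambda>(i, j). if Suc i < n then g $$ (Suc i, j) else cyc_sign \<epsilon> * g $$ (0, j))"

text \<open>The shift is linear, so it maps combinations of columns to combinations of shifted
  columns.\<close>

lemma cyc_flag_flag_of:
  assumes g: "g \<in> carrier_mat n n" and K: "K \<subseteq> {..n}"
  shows "cyc_flag n K \<epsilon> (flag_of n K g) = flag_of n K (cyc_mat n \<epsilon> g)"
proof
  fix k
  show "cyc_flag n K \<epsilon> (flag_of n K g) k = flag_of n K (cyc_mat n \<epsilon> g) k"
  proof (cases "k \<in> K")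
    case True
    then have "k \<le> n"
      using K by auto
    have "cyc n \<epsilon> (mat n k (($$) g) *\<^sub>v c) = mat n k (($$) (cyc_mat n \<epsilon> g)) *\<^sub>v c"
      if "c \<in> carrier_vec k" for c
      using that \<open>k \<le> n\<close>
      by (intro eq_vecI)
        (auto simp: cyc_def cyc_mat_def cyc_sign_def scalar_prod_def sum_distrib_left mult.assoc
          intro!: sum.cong)
    then have "cyc n \<epsilon> ` {mat n k (($$) g) *\<^sub>v c |c. c \<in> carrier_vec k} =
        {mat n k (($$) (cyc_mat n \<epsilon> g)) *\<^sub>v c |c. c \<in> carrier_vec k}"
      by (simp add: Setcompr_eq_image image_image)
    moreover have "cyc_mat n \<epsilon> g \<in> carrier_mat n n"
      by (simp add: cyc_mat_def)
    ultimately show ?thesis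
      using True g \<open>k \<le> n\<close> by (simp add: cyc_flag_def flag_of_eq_range)
  qed (simp add: cyc_flag_def flag_of_def)
qed

lemma flag_minor_cyc_mat:
  assumes "\<And>i. i < m \<Longrightarrow> Suc (r i) < n" and "m \<le> n"
  shows "flag_minor (cyc_mat n \<epsilon> g) m r = flag_minor g m (\<lambda>i. Suc (r i))"
  unfolding flag_minor_def using assms
  by (intro arg_cong[of _ _ det] cong_mat) (auto simp: cyc_mat_def Suc_lessD)

text \<open>The last row of the shift is row \<open>0\<close> of \<open>g\<close> up to sign;
  rotating it to the front restores the initial rows of \<open>g\<close>.\<close>

lemma border_minor_cyc_mat_last:
  assumes "p < n"
  shows "border_minor (cyc_mat n \<epsilon> g) p (n - 1) =
    cyc_sign \<epsilon> * (- 1) ^ p * flag_minor g (Suc p) (\<lambda>i. i)"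
proof -
  have "border_minor (cyc_mat n \<epsilon> g) p (n - 1) =
      det (mat (Suc p) (Suc p) (\<lambda>(i, j). if i < p then g $$ (Suc i, j) else cyc_sign \<epsilon> * g $$ (0, j)))"
    unfolding border_minor_def flag_minor_def using assms
    by (intro arg_cong[of _ _ det] cong_mat) (auto simp: cyc_mat_def)
  also have "\<dots> = cyc_sign \<epsilon> * (- 1) ^ p * flag_minor g (Suc p) (\<lambda>i. i)"
    unfolding flag_minor_def by (rule det_rotate_rows[of p "\<lambda>i j. g $$ (i, j)"])
  finally show ?thesis .
qed

lemma cyc_sign_neq_0: "cyc_sign \<epsilon> \<noteq> 0"
  by (simp add: cyc_sign_def)

lemma cyc_sign_cases: "cyc_sign \<epsilon> * (- 1) ^ p = 1 \<or> cyc_sign \<epsilon> * (- 1) ^ p = - 1"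
  by (cases "even p"; cases "even (of_bit (\<epsilon> - 1) :: nat)") (auto simp: cyc_sign_def)

text \<open>The determinant is itself the border minor of index \<open>n - 1\<close> in the last
  row, already computed up to sign.\<close>

lemma cyc_mat_in_GL:
  assumes g: "g \<in> GL n" and "0 < n"
  shows "cyc_mat n \<epsilon> g \<in> GL n"
proof -
  have full: "flag_minor h n (\<lambda>i. i) = det h" if "h \<in> carrier_mat n n" for h
    unfolding flag_minor_def using that by (intro arg_cong[of _ _ det] eq_matI) auto
  have carrier: "cyc_mat n \<epsilon> g \<in> carrier_mat n n"
    by (simp add: cyc_mat_def)
  have "Suc (n - 1) = n"
    using \<open>0 < n\<close> by simp
  then have "border_minor (cyc_mat n \<epsilon> g) (n - 1) (n - 1) = flag_minor (cyc_mat n \<epsilon> g) n (\<lambda>i. i)"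
    unfolding border_minor_def by (simp only:) (intro flag_minor_cong, auto)
  with full[OF carrier] have "det (cyc_mat n \<epsilon> g) = border_minor (cyc_mat n \<epsilon> g) (n - 1) (n - 1)"
    by simp
  also have "\<dots> = cyc_sign \<epsilon> * (- 1) ^ (n - 1) * det g"
    using border_minor_cyc_mat_last[of "n - 1" n \<epsilon> g] full[of g] g \<open>0 < n\<close> by (simp add: GL_iff_det)
  finally show ?thesis
    using g carrier cyc_sign_neq_0 by (simp add: GL_iff_det)
qed

section \<open>Two obstructions to lying in the closure\<close>

text \<open>The factor \<open>d\<close> does not depend on \<open>q\<close>, so products of two
  minors with the same \<open>k\<close> scale by a square.\<close>

lemma border_minor_same_flag:
  assumes "g \<in> GL n" "g' \<in> GL n" and eq: "flag_of n K g = flag_of n K g'"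
    and "k \<in> K" "1 \<le> k" "k < n"
  obtains d where "\<And>q. q < n \<Longrightarrow> border_minor g' (k - 1) q = border_minor g (k - 1) q * d"
proof -
  have "g \<in> carrier_mat n n" "g' \<in> carrier_mat n n"
    using assms by (auto simp: GL_def)
  then obtain d where d: "\<And>r. (\<And>i. i < k \<Longrightarrow> r i < n) \<Longrightarrow> flag_minor g' k r = flag_minor g k r * d"
    using flag_minor_same_flag[OF _ _ \<open>k \<in> K\<close> _ eq] \<open>k < n\<close> by (metis less_imp_le)
  have "border_minor g' (k - 1) q = border_minor g (k - 1) q * d" if "q < n" for q
    using d[of "\<lambda>i. if i < k - 1 then i else q"] that \<open>1 \<le> k\<close> \<open>k < n\<close>
    by (simp add: border_minor_def)
  then show thesis
    by (rule that)
qed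

lemma flag_of_notin_Fl_nonneg_border:
  assumes K: "K \<subseteq> {1..n - 1}" and k: "k \<in> K" and h: "h \<in> GL n"
    and pos: "0 < border_minor h (k - 1) (k - 1)" and neg: "border_minor h (k - 1) (n - 1) < 0"
  shows "flag_of n K h \<notin> Fl_nonneg n K"
proof -
  note K' = dims_bounds(3)[OF K]
  have "1 \<le> k" "k < n"
    using k by (rule dims_bounds[OF K])+
  then have Suc: "Suc (k - 1) = k"
    by simp
  define F where "F g = border_minor g (k - 1) (k - 1) * border_minor g (k - 1) (n - 1)" for g
  show ?thesis
  proof (rule flag_of_notin_Fl_nonneg[OF K' h, of F])
    show "F h < 0"
      using pos neg by (simp add: F_def mult_less_0_iff)
    show "continuous_map (mat_topology n) euclideanreal F"
      unfolding F_def border_minor_def Suc using \<open>k < n\<close>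
      by (intro continuous_map_real_mult continuous_map_flag_minor) auto
    show "0 \<le> F g" if "g \<in> carrier_mat n n" "all_minors_pos n g" for g
      unfolding F_def using \<open>k < n\<close>
      by (intro mult_nonneg_nonneg less_imp_le[OF border_minor_pos[OF that]]) auto
    show "\<exists>d. F g' = F g * d\<^sup>2" if g: "g \<in> GL n" "g' \<in> GL n" "flag_of n K g = flag_of n K g'" for g g'
    proof -
      obtain d where d: "\<And>q. q < n \<Longrightarrow> border_minor g' (k - 1) q = border_minor g (k - 1) q * d"
        using border_minor_same_flag[OF g k \<open>1 \<le> k\<close> \<open>k < n\<close>] by blast
      have "F g' = F g * d\<^sup>2"
        unfolding F_def using \<open>k < n\<close> by (subst (1 2) d) (auto simp: power2_eq_square)
      then show ?thesis
        by blast
    qed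
  qed
qed

lemma flag_of_notin_Fl_nonneg_ratio:
  assumes K: "K \<subseteq> {1..n - 1}" and k: "k \<in> K" and l: "l \<in> K" and "k < l" and h: "h \<in> GL n"
    and pos: "0 < border_minor h (k - 1) (l - 1)" "0 < border_minor h (l - 1) (l - 1)"
    and less: "border_minor h (k - 1) (l - 1) * border_minor h (l - 1) (n - 1) <
      border_minor h (k - 1) (n - 1) * border_minor h (l - 1) (l - 1)"
  shows "flag_of n K h \<notin> Fl_nonneg n K"
proof -
  note K' = dims_bounds(3)[OF K]
  have "1 \<le> k" "l < n"
    using k l by (auto dest: dims_bounds(1,2)[OF K])
  then have Suc: "Suc (k - 1) = k" "Suc (l - 1) = l"
    using \<open>k < l\<close> by simp_all
  \<comment> \<open>The first factor alone scales by \<open>d * e\<close>, which may be negative.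
    The second scales by \<open>d * e\<close> as well and is positive at \<open>h\<close>, so the
    product has a sign that depends on the flag only.\<close>
  define F where "F g = (border_minor g (k - 1) (l - 1) * border_minor g (l - 1) (n - 1) -
      border_minor g (k - 1) (n - 1) * border_minor g (l - 1) (l - 1)) *
    (border_minor g (k - 1) (l - 1) * border_minor g (l - 1) (l - 1))" for g
  show ?thesis
  proof (rule flag_of_notin_Fl_nonneg[OF K' h, of F])
    show "F h < 0"
      using pos less by (simp add: F_def mult_less_0_iff)
    show "continuous_map (mat_topology n) euclideanreal F"
      unfolding F_def border_minor_def Suc using \<open>k < l\<close> \<open>l < n\<close>
      by (intro continuous_map_real_mult continuous_map_diff continuous_map_flag_minor) auto
    show "0 \<le> F g" if "g \<in> carrier_mat n n" "all_minors_pos n g" for g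
    proof -
      have "0 < border_minor g (k - 1) (l - 1)" "0 < border_minor g (l - 1) (l - 1)"
        using \<open>k < l\<close> \<open>l < n\<close> by (intro border_minor_pos[OF that]; simp)+
      moreover have "border_minor g (k - 1) (n - 1) * border_minor g (l - 1) (l - 1) \<le>
          border_minor g (k - 1) (l - 1) * border_minor g (l - 1) (n - 1)"
        using \<open>1 \<le> k\<close> \<open>k < l\<close> \<open>l < n\<close> by (intro border_minor_ratio_antimono[OF that]) auto
      ultimately show ?thesis
        by (simp add: F_def)
    qed
    show "\<exists>d. F g' = F g * d\<^sup>2" if g: "g \<in> GL n" "g' \<in> GL n" "flag_of n K g = flag_of n K g'" for g g'
    proof -
      obtain d where d: "\<And>q. q < n \<Longrightarrow> border_minor g' (k - 1) q = border_minor g (k - 1) q * d"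
        using border_minor_same_flag[OF g k \<open>1 \<le> k\<close>] \<open>k < l\<close> \<open>l < n\<close> by (metis less_trans)
      obtain e where e: "\<And>q. q < n \<Longrightarrow> border_minor g' (l - 1) q = border_minor g (l - 1) q * e"
        using border_minor_same_flag[OF g l _ \<open>l < n\<close>] \<open>1 \<le> k\<close> \<open>k < l\<close> by (metis less_imp_le le_trans)
      have "l - 1 < n" "n - 1 < n"
        using \<open>l < n\<close> by auto
      then have "F g' = F g * (d * e)\<^sup>2"
        by (simp only: F_def d e) (simp add: power2_eq_square algebra_simps)
      then show ?thesis
        by blast
    qed
  qed
qed

text \<open>In \<open>det_cauchy_mat_Suc\<close> only the first quotient involves \<open>x 0\<close>, so the minors \<open>A p\<close>, in which the
  node \<open>x l\<close> takes the place of \<open>x 0\<close>, share the factor \<open>\<kappa> p\<close> with the minors \<open>B p\<close>.\<close>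

lemma cauchy_border_minor_ratio:
  fixes x y :: "nat \<Rightarrow> real"
  assumes x: "strict_mono x" and y: "strict_mono y" and pos: "\<And>i j. 0 < x i + y j"
    and gap: "\<And>c. 0 < c \<Longrightarrow> c < l \<Longrightarrow> (x c - x 0) * (x l + y c) < (x l - x c) * (x 0 + y c)"
    and "p < p'" and "p' < l" and "l < n"
  defines "g \<equiv> cauchy_mat n x y"
  defines "A \<equiv> \<lambda>p. flag_minor g (Suc p) (\<lambda>i. if i < p then Suc i else l)"
    and "B \<equiv> \<lambda>p. flag_minor g (Suc p) (\<lambda>i. i)"
  shows "A p * B p' < B p * A p'"
proof -
  \<comment> \<open>\<open>\<beta>\<close> is the first quotient of the Cauchy recursion;
    \<open>\<alpha>\<close> is its analogue for the node \<open>x l\<close>, with the differences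
    reversed to make them positive for \<open>p < l\<close>.\<close>
  define \<alpha> where "\<alpha> p = (\<Prod>i<p. x l - x (Suc i)) / (\<Prod>j\<le>p. x l + y j)" for p
  define \<beta> where "\<beta> p = (\<Prod>i<p. x (Suc i) - x 0) / (\<Prod>j\<le>p. x 0 + y j)" for p
  define \<kappa> where "\<kappa> p = (\<Prod>j<p. y (Suc j) - y 0) / (\<Prod>i<p. x (Suc i) + y 0) *
      det (cauchy_mat p (\<lambda>i. x (Suc i)) (\<lambda>j. y (Suc j)))" for p
  have x_less: "x i < x j" if "i < j" for i j
    using x that by (simp add: strict_mono_def)
  have B: "B p = \<beta> p * \<kappa> p" if "p < n" for p
  proof -
    have "B p = det (cauchy_mat (Suc p) x y)"
      unfolding B_def flag_minor_def g_def using that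
      by (intro arg_cong[of _ _ det] cong_mat) auto
    then show ?thesis
      using det_cauchy_mat_Suc[of p x y] pos by (simp add: \<beta>_def \<kappa>_def)
  qed
  have A: "A p = \<alpha> p * \<kappa> p" if "p < l" for p
  proof -
    \<comment> \<open>Rotating row \<open>l\<close> to the front and reversing the \<open>p\<close>
      differences each cost \<open>(- 1) ^ p\<close>, so the signs cancel. The recursion holds for
      nodes in any order, in particular for \<open>?x\<close>.\<close>
    let ?x = "x(0 := x l)"
    have "A p = det (mat (Suc p) (Suc p)
        (\<lambda>(i, j). if i < p then 1 / (?x (Suc i) + y j) else 1 * (1 / (?x 0 + y j))))"
      unfolding A_def flag_minor_def g_def using that \<open>l < n\<close>
      by (intro arg_cong[of _ _ det] cong_mat) auto
    also have "\<dots> = (- 1) ^ p * det (cauchy_mat (Suc p) ?x y)"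
      by (subst det_rotate_rows[of p "\<lambda>i j. 1 / (?x i + y j)" 1]) simp
    also have "\<dots> = (- 1) ^ p * ((\<Prod>i<p. x (Suc i) - x l) / (\<Prod>j\<le>p. x l + y j) * \<kappa> p)"
      using det_cauchy_mat_Suc[of p ?x y] pos by (simp add: \<kappa>_def)
    also have "(\<Prod>i<p. x (Suc i) - x l) = (- 1) ^ p * (\<Prod>i<p. x l - x (Suc i))"
      using prod.distrib[of "\<lambda>_. - 1" "\<lambda>i. x l - x (Suc i)" "{..<p}"] by simp
    finally show ?thesis
      by (simp add: \<alpha>_def flip: power_add mult.assoc)
  qed
  have prod_pos: "0 < (\<Prod>j\<le>p. x i + y j)" for i p
    using pos by (intro prod_pos) auto
  have \<beta>_pos: "0 < \<beta> p" for p
    unfolding \<beta>_def using x_less by (intro divide_pos_pos prod_pos) (simp add: Groups_Big.prod_pos)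
  have \<alpha>_pos: "0 < \<alpha> p" if "p < l" for p
    unfolding \<alpha>_def using x_less that
    by (intro divide_pos_pos prod_pos Groups_Big.prod_pos) simp
  have \<kappa>_pos: "0 < \<kappa> p" if "p < n" for p
  proof -
    have "0 < B p"
      unfolding B_def g_def using that
      by (intro flag_minor_pos[OF _ all_minors_pos_cauchy_mat[OF x y pos]]) auto
    then show ?thesis
      using B[OF that] \<beta>_pos[of p] by (simp add: zero_less_mult_iff)
  qed
  \<comment> \<open>The quotient is multiplied by a number that \<open>gap\<close> with
    \<open>c = Suc m\<close> puts above \<open>1\<close>.\<close>
  have step: "\<alpha> m / \<beta> m < \<alpha> (Suc m) / \<beta> (Suc m)" if "Suc m < l" for m
  proof -
    have "\<alpha> (Suc m) / \<beta> (Suc m) = \<alpha> m / \<beta> m *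
        (((x l - x (Suc m)) * (x 0 + y (Suc m))) / ((x (Suc m) - x 0) * (x l + y (Suc m))))"
      by (simp add: \<alpha>_def \<beta>_def mult_ac)
    moreover have "1 < ((x l - x (Suc m)) * (x 0 + y (Suc m))) / ((x (Suc m) - x 0) * (x l + y (Suc m)))"
      using gap[of "Suc m"] that pos x_less[of 0 "Suc m"] by (simp add: less_divide_eq_1_pos)
    moreover have "0 < \<alpha> m / \<beta> m"
      using \<alpha>_pos \<beta>_pos that by simp
    ultimately show ?thesis
      by (simp only: mult_less_cancel_left1) simp
  qed
  have "\<alpha> p / \<beta> p < \<alpha> p' / \<beta> p'"
    using \<open>p < p'\<close> \<open>p' < l\<close>
  proof (induction p')
    case (Suc m)
    then show ?case
      using step[of m] by (cases "p = m") auto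
  qed simp
  \<comment> \<open>It remains to multiply by the common positive factor
    \<open>\<kappa> p * \<kappa> p'\<close>.\<close>
  then have "\<alpha> p * \<beta> p' < \<beta> p * \<alpha> p'"
    using \<beta>_pos by (simp add: field_simps)
  then show ?thesis
    using A[of p] A[of p'] B[of p] B[of p'] \<kappa>_pos[of p] \<kappa>_pos[of p'] \<open>p < p'\<close> \<open>p' < l\<close> \<open>l < n\<close>
    by (simp add: mult_less_cancel_right_pos)
qed

theorem theorem1p3:
  fixes n :: nat and K :: "nat set" and \<epsilon> :: bit
  assumes "K \<subseteq> {1..n - 1}" and "card K \<ge> 2"
  shows "(\<exists>V \<in> Fl_pos n K. cyc_flag n K \<epsilon> V \<notin> Fl_nonneg n K) \<and>
         \<not> cyc_flag n K \<epsilon> ` Fl_pos n K \<subseteq> Fl_pos n K \<and>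
         \<not> cyc_flag n K \<epsilon> ` Fl_nonneg n K \<subseteq> Fl_nonneg n K"
proof -
  have K: "K \<subseteq> {..n}"
    using assms(1) by (rule dims_bounds)
  then have "finite K"
    by (rule finite_subset) simp
  obtain k l where kl: "k \<in> K" "l \<in> K" "k < l"
  proof -
    obtain a b where "a \<in> K" "b \<in> K" "a \<noteq> b"
      using card_le_Suc0_iff_eq[OF \<open>finite K\<close>] assms(2) by auto
    then show thesis
      using that by (cases a b rule: linorder_cases) auto
  qed
  then have "1 \<le> k" "l < n"
    using dims_bounds[OF assms(1)] by auto
  \<comment> \<open>The nodes \<open>x l\<close> and \<open>y c\<close> are at least
    \<open>4 * n\<close>, which exceeds \<open>4 * c\<close> for every \<open>c < l\<close>; this
    gives \<open>gap\<close>.\<close>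
  define x where "x i = real (if i < l then i else 4 * n + i)" for i
  define y where "y j = real (4 * n + j)" for j
  have x: "strict_mono x" and y: "strict_mono y"
    by (auto simp: strict_mono_def x_def y_def)
  have pos: "0 < x i + y j" for i j
    using \<open>l < n\<close> by (auto simp: x_def y_def)
  have gap: "(x c - x 0) * (x l + y c) < (x l - x c) * (x 0 + y c)" if "0 < c" "c < l" for c
  proof -
    have "x c = real c" "x 0 = 0" "4 * real c < x l" "2 * real c < y c"
      using that \<open>l < n\<close> by (auto simp: x_def y_def)
    \<comment> \<open>As \<open>x 0 = 0\<close>, this expression is twice the difference of the two
      sides of \<open>gap\<close>.\<close>
    moreover have "0 < y c * (x l - 4 * real c) + x l * (y c - 2 * real c)"
      using calculation by (intro add_pos_pos mult_pos_pos) auto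
    ultimately show ?thesis
      by (simp add: algebra_simps)
  qed
  define g where "g = cauchy_mat n x y"
  define h where "h = cyc_mat n \<epsilon> g"
  have g: "g \<in> carrier_mat n n" "all_minors_pos n g"
    by (auto simp: g_def intro: all_minors_pos_cauchy_mat[OF x y pos])
  have h: "h \<in> GL n"
    unfolding h_def using all_minors_pos_imp_GL[OF g] \<open>l < n\<close> by (intro cyc_mat_in_GL) auto
  have last: "border_minor h p (n - 1) = cyc_sign \<epsilon> * (- 1) ^ p * flag_minor g (Suc p) (\<lambda>i. i)"
    if "p < n" for p
    unfolding h_def using that by (rule border_minor_cyc_mat_last)
  have shift: "border_minor h p q = flag_minor g (Suc p) (\<lambda>i. if i < p then Suc i else Suc q)"
    if "p \<le> q" "Suc q < n" for p q
    unfolding h_def border_minor_def using that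
    by (subst flag_minor_cyc_mat) (auto intro!: flag_minor_cong)
  have shift_pos: "0 < border_minor h p q" if "p \<le> q" "Suc q < n" for p q
    unfolding shift[OF that] using that by (intro flag_minor_pos[OF g]) auto
  have notin: "flag_of n K h \<notin> Fl_nonneg n K"
  proof (cases "\<exists>m\<in>K. cyc_sign \<epsilon> * (- 1) ^ (m - 1) = - 1")
    case True
    then obtain m where m: "m \<in> K" "cyc_sign \<epsilon> * (- 1) ^ (m - 1) = - 1"
      by blast
    then have "1 \<le> m" "m < n"
      using dims_bounds[OF assms(1)] by auto
    show ?thesis
    proof (rule flag_of_notin_Fl_nonneg_border[OF assms(1) m(1) h])
      show "0 < border_minor h (m - 1) (m - 1)"
        using \<open>1 \<le> m\<close> \<open>m < n\<close> by (intro shift_pos) auto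
      have "0 < flag_minor g (Suc (m - 1)) (\<lambda>i. i)"
        using \<open>1 \<le> m\<close> \<open>m < n\<close> by (intro flag_minor_pos[OF g]) auto
      then show "border_minor h (m - 1) (n - 1) < 0"
        using last[of "m - 1"] m(2) \<open>m < n\<close> by simp
    qed
  next
    case False
    then have sign: "cyc_sign \<epsilon> * (- 1) ^ (m - 1) = 1" if "m \<in> K" for m
      using cyc_sign_cases that by blast
    show ?thesis
    proof (rule flag_of_notin_Fl_nonneg_ratio[OF assms(1) kl h])
      show "0 < border_minor h (k - 1) (l - 1)" "0 < border_minor h (l - 1) (l - 1)"
        using \<open>1 \<le> k\<close> \<open>k < l\<close> \<open>l < n\<close> by (intro shift_pos; simp)+
      \<comment> \<open>Row \<open>l - 1\<close> of the shift is row \<open>l\<close> of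
        \<open>g\<close>. The minors of \<open>h\<close> ending in rows \<open>l - 1\<close> and
        \<open>n - 1\<close> are thus the \<open>A\<close> and \<open>B\<close> of
        \<open>cauchy_border_minor_ratio\<close>.\<close>
      have "border_minor h p (l - 1) = flag_minor g (Suc p) (\<lambda>i. if i < p then Suc i else l)"
        if "p \<le> l - 1" for p
      proof -
        have "Suc (l - 1) = l"
          using \<open>k < l\<close> by simp
        with shift[of p "l - 1"] that \<open>l < n\<close> show ?thesis
          by (simp only:)
      qed
      moreover have "border_minor h (m - 1) (n - 1) = flag_minor g (Suc (m - 1)) (\<lambda>i. i)" if "m \<in> K" "m < n" for m
        using last[of "m - 1"] sign[OF that(1)] that(2) by simp
      ultimately show "border_minor h (k - 1) (l - 1) * border_minor h (l - 1) (n - 1) <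
          border_minor h (k - 1) (n - 1) * border_minor h (l - 1) (l - 1)"
        using cauchy_border_minor_ratio[OF x y pos gap, where p = "k - 1" and p' = "l - 1" and n = n] kl \<open>1 \<le> k\<close> \<open>l < n\<close>
        by (simp add: g_def)
    qed
  qed
  \<comment> \<open>\<open>V\<close> lies in both sets and its shift in neither, so this one flag
    settles all three claims.\<close>
  define V where "V = flag_of n K g"
  have V: "V \<in> Fl_pos n K" "V \<in> Fl_nonneg n K"
    using g Fl_pos_subset_Fl_nonneg[OF K] by (auto simp: V_def Fl_pos_def)
  moreover have "cyc_flag n K \<epsilon> V \<notin> Fl_nonneg n K"
    using notin cyc_flag_flag_of[OF g(1) K] by (simp add: V_def h_def)
  ultimately show ?thesis
    using Fl_pos_subset_Fl_nonneg[OF K] by blast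
qed

end
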